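(* Let $V$ be a finite-dimensional vector space over a field $K$ and let $f : V \to V$ be a $K$-linear map all of whose eigenvalues lie in $K$ (that is, the characteristic polynomial of $f$ splits over $K$). Let $\mathrm{Hinv}(V)$, $\mathrm{Chinv}(V)$ and $\mathrm{Mark}(V)$ be the sets of hyperinvariant, characteristic and marked subspaces of $V$ with respect to $f$, respectively. Then $$\mathrm{Hinv}(V) = \mathrm{Chinv}(V) \cap \mathrm{Mark}(V).$$
   Context: Let $\mathrm{End}_f(V)$ be the algebra of all $K$-linear endomorphisms of $V$ that commute with $f$, $\mathrm{Aut}_f(V)$ the group of all $K$-linear automorphisms of $V$ that commute with $f$, and $\mathrm{Inv}(V)$ the lattice of $f$-invariant subspaces of $V$. Let $\iota$ be the identity map of $V$. A subspace $X \subseteq V$ is hyperinvariant (for $f$) if $g(X) \subseteq X$ for all $g \in \mathrm{End}_f(V)$. A subspace $X$ is characteristic (with respect to $f$) if $X \in \mathrm{Inv}(V)$ and $\alpha(X) = X$ for all $\alpha \in \mathrm{Aut}_f(V)$. For an endomorphism $h$ and a vector $x$ put $\langle x \rangle_h = \mathrm{span}\{h^i x : i \ge 0\}$. For an eigenvalue $\lambda$ of $f$ let $V_\lambda = \mathrm{Ker}(f - \lambda\iota)^n$, $n = \dim V$, be the generalized eigenspace, and let $s^{t_1}, \dots, s^{t_k}$ be the elementary divisors of the nilpotent map $(f-\lambda\iota)_{|V_\lambda}$ ($k = \dim \mathrm{Ker}(f-\lambda\iota)$). A set of generators of $V_\lambda$ is a set $\{u_1, \dots, u_k\}$ of vectors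 with $V_\lambda = \langle u_1\rangle_{f-\lambda\iota} \oplus \cdots \oplus \langle u_k\rangle_{f-\lambda\iota}$, $(f-\lambda\iota)^{t_i - 1}u_i \neq 0$ and $(f-\lambda\iota)^{t_i}u_i = 0$ for $i = 1,\dots,k$. An $f$-invariant subspace $Y \subseteq V_\lambda$ is marked in $V_\lambda$ if there exist a set of generators $\{u_1,\dots,u_k\}$ of $V_\lambda$ and integers $r_i$ with $0 \le r_i \le t_i$ such that $Y = \langle (f-\lambda\iota)^{r_1}u_1\rangle_{f-\lambda\iota} \oplus \cdots \oplus \langle (f-\lambda\iota)^{r_k}u_k\rangle_{f-\lambda\iota}$. Let $\lambda_1, \dots, \lambda_m$ be the distinct eigenvalues of $f$. An $f$-invariant subspace $X \subseteq V$ is marked in $V$ if each component $X_{\lambda_i} = X \cap V_{\lambda_i}$, $i = 1, \dots, m$, is marked in $V_{\lambda_i}$. The zero subspace is marked. *)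

theory Defs
  imports "Jordan_Normal_Form.Char_Poly"
begin

context
  fixes scale :: "'a::field \<Rightarrow> 'b::ab_group_add \<Rightarrow> 'b" (infixr \<open>*s\<close> 75)
begin

subsection \<open>Characteristic polynomial of an endomorphism\<close>

definition basis_list :: "'b list \<Rightarrow> bool" where
  "basis_list bs \<longleftrightarrow> distinct bs \<and> \<not> module.dependent scale (set bs) \<and> module.span scale (set bs) = UNIV"

(* Column j holds the coordinates of g (bs ! j) with respect to cs. *)
definition matrix_wrt :: "'b list \<Rightarrow> 'b list \<Rightarrow> ('b \<Rightarrow> 'b) \<Rightarrow> 'a mat" where
  "matrix_wrt bs cs g =
     mat (length cs) (length bs) (\<lambda>(i, j). module.representation scale (set cs) (g (bs ! j)) (cs ! i))"

(* The choice of the basis is immaterial, see char_polynomial_eq below. *)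
definition char_polynomial :: "('b \<Rightarrow> 'b) \<Rightarrow> 'a poly" where
  "char_polynomial f = (let bs = (SOME bs. basis_list bs) in char_poly (matrix_wrt bs bs f))"

definition char_polynomial_splits :: "('b \<Rightarrow> 'b) \<Rightarrow> bool" where
  "char_polynomial_splits f \<longleftrightarrow> (\<exists>as. char_polynomial f = (\<Prod>a\<leftarrow>as. [:- a, 1:]))"

subsection \<open>Invariant, hyperinvariant and characteristic subspaces\<close>

definition End_comm :: "('b \<Rightarrow> 'b) \<Rightarrow> ('b \<Rightarrow> 'b) set" where
  "End_comm f = {g. Vector_Spaces.linear scale scale g \<and> g \<circ> f = f \<circ> g}"

definition Aut_comm :: "('b \<Rightarrow> 'b) \<Rightarrow> ('b \<Rightarrow> 'b) set" where
  "Aut_comm f = {g \<in> End_comm f. bij g}"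

definition Inv :: "('b \<Rightarrow> 'b) \<Rightarrow> 'b set set" where
  "Inv f = {X. module.subspace scale X \<and> f ` X \<subseteq> X}"

definition Hinv :: "('b \<Rightarrow> 'b) \<Rightarrow> 'b set set" where
  "Hinv f = {X. module.subspace scale X \<and> (\<forall>g \<in> End_comm f. g ` X \<subseteq> X)}"

definition Chinv :: "('b \<Rightarrow> 'b) \<Rightarrow> 'b set set" where
  "Chinv f = {X \<in> Inv f. \<forall>g \<in> Aut_comm f. g ` X = X}"


subsection \<open>Marked subspaces\<close>

definition cyclic_subspace :: "('b \<Rightarrow> 'b) \<Rightarrow> 'b \<Rightarrow> 'b set" where
  "cyclic_subspace h x = module.span scale {(h ^^ i) x |i. True}"

definition internal_direct_sum :: "nat \<Rightarrow> (nat \<Rightarrow> 'b set) \<Rightarrow> 'b set \<Rightarrow> bool" where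
  "internal_direct_sum k A W \<longleftrightarrow>
     W = {\<Sum>i<k. a i |a. \<forall>i<k. a i \<in> A i} \<and>
     (\<forall>a. (\<forall>i<k. a i \<in> A i) \<and> (\<Sum>i<k. a i) = 0 \<longrightarrow> (\<forall>i<k. a i = 0))"

definition shifted :: "('b \<Rightarrow> 'b) \<Rightarrow> 'a \<Rightarrow> 'b \<Rightarrow> 'b" where
  "shifted f c = (\<lambda>x. f x - c *s x)"

definition is_eigenvalue :: "('b \<Rightarrow> 'b) \<Rightarrow> 'a \<Rightarrow> bool" where
  "is_eigenvalue f c \<longleftrightarrow> (\<exists>v. v \<noteq> 0 \<and> f v = c *s v)"

definition gen_eigenspace :: "('b \<Rightarrow> 'b) \<Rightarrow> 'a \<Rightarrow> 'b set" where
  "gen_eigenspace f c = {v. (shifted f c ^^ vector_space.dim scale UNIV) v = 0}"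

(* The indices 1, ..., k of the mathematical notation are shifted to 0, ..., k - 1. *)
definition generators :: "('b \<Rightarrow> 'b) \<Rightarrow> 'b set \<Rightarrow> nat \<Rightarrow> (nat \<Rightarrow> nat) \<Rightarrow> (nat \<Rightarrow> 'b) \<Rightarrow> bool" where
  "generators h W k t u \<longleftrightarrow>
     internal_direct_sum k (\<lambda>i. cyclic_subspace h (u i)) W \<and>
     (\<forall>i<k. (h ^^ (t i - 1)) (u i) \<noteq> 0 \<and> (h ^^ t i) (u i) = 0)"

(* s^(t 0), ..., s^(t (k - 1)) are the elementary divisors of h restricted to W, for h nilpotent
   on W: the K[s]-module W is a direct sum of cyclic modules isomorphic to K[s]/(s^(t i)) with
   t i > 0. They are determined by h and W only up to their order, hence a predicate. *)
definition elementary_divisors :: "('b \<Rightarrow> 'b) \<Rightarrow> 'b set \<Rightarrow> nat \<Rightarrow> (nat \<Rightarrow> nat) \<Rightarrow> bool" where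
  "elementary_divisors h W k t \<longleftrightarrow> (\<forall>i<k. 0 < t i) \<and> (\<exists>u. generators h W k t u)"

(* Here W is h-invariant and h is nilpotent on W; for W = gen_eigenspace f c take
   h = shifted f c. *)
definition marked_in :: "('b \<Rightarrow> 'b) \<Rightarrow> 'b set \<Rightarrow> 'b set \<Rightarrow> bool" where
  "marked_in h W Y \<longleftrightarrow>
     Y = {0} \<or>
     (\<exists>k t u r. elementary_divisors h W k t \<and> generators h W k t u \<and>
        (\<forall>i<k. r i \<le> t i) \<and>
        internal_direct_sum k (\<lambda>i. cyclic_subspace h ((h ^^ r i) (u i))) Y)"

definition Mark :: "('b \<Rightarrow> 'b) \<Rightarrow> 'b set set" where
  "Mark f = {X \<in> Inv f. \<forall>c. is_eigenvalue f c \<longrightarrow>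
     marked_in (shifted f c) (gen_eigenspace f c) (X \<inter> gen_eigenspace f c)}"

end


subsection \<open>Basis independence of the characteristic polynomial\<close>

context vector_space
begin

lemma basis_list_coordinates:
  assumes "basis_list scale cs"
  shows "(\<Sum>k<length cs. representation (set cs) v (cs ! k) *s cs ! k) = v"
proof -
  have "(\<Sum>k<length cs. representation (set cs) v (cs ! k) *s cs ! k)
      = (\<Sum>c\<in>set cs. representation (set cs) v c *s c)"
    by (rule sum.reindex_bij_betw)
       (use assms in \<open>auto simp: basis_list_def intro!: bij_betw_nth\<close>)
  also have "\<dots> = v"
    using assms by (intro sum_representation_eq) (auto simp: basis_list_def)
  finally show ?thesis .
qed

lemma matrix_wrt_comp:
  assumes cs: "basis_list scale cs" and ds: "basis_list scale ds"
    and g: "Vector_Spaces.linear scale scale g"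
  shows "matrix_wrt scale bs ds (g \<circ> h) = matrix_wrt scale cs ds g * matrix_wrt scale bs cs h"
proof (rule eq_matI)
  fix i j
  assume "i < dim_row (matrix_wrt scale cs ds g * matrix_wrt scale bs cs h)"
    and "j < dim_col (matrix_wrt scale cs ds g * matrix_wrt scale bs cs h)"
  then have i: "i < length ds" and j: "j < length bs"
    by (auto simp: matrix_wrt_def)
  interpret g: Vector_Spaces.linear scale scale g by (fact g)
  have ids: "independent (set ds)" and sds: "span (set ds) = UNIV"
    using ds by (auto simp: basis_list_def)
  let ?v = "h (bs ! j)"
  let ?r = "\<lambda>k. representation (set cs) ?v (cs ! k)"
  have "g ?v = g (\<Sum>k<length cs. ?r k *s cs ! k)"
    by (simp only: basis_list_coordinates[OF cs])
  also have "\<dots> = (\<Sum>k<length cs. ?r k *s g (cs ! k))"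
    by (simp add: g.sum g.scale)
  finally have "representation (set ds) (g ?v) (ds ! i)
      = (\<Sum>k<length cs. representation (set ds) (g (cs ! k)) (ds ! i) * ?r k)"
    using ids sds by (simp add: representation_sum representation_scale mult.commute)
  then show "matrix_wrt scale bs ds (g \<circ> h) $$ (i, j)
      = (matrix_wrt scale cs ds g * matrix_wrt scale bs cs h) $$ (i, j)"
    using i j by (simp add: matrix_wrt_def scalar_prod_def atLeast0LessThan)
qed (auto simp: matrix_wrt_def)

lemma matrix_wrt_id:
  assumes "basis_list scale bs"
  shows "matrix_wrt scale bs bs id = 1\<^sub>m (length bs)"
  by (rule eq_matI)
     (use assms in \<open>auto simp: matrix_wrt_def basis_list_def representation_basis nth_eq_iff_index_eq\<close>)

lemma char_polynomial_eq:
  assumes bs: "basis_list scale bs" and f: "Vector_Spaces.linear scale scale f"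
  shows "char_polynomial scale f = char_poly (matrix_wrt scale bs bs f)"
proof -
  define cs where "cs = (SOME bs. basis_list scale bs)"
  have cs: "basis_list scale cs"
    unfolding cs_def using bs by (rule someI)
  have len: "length cs = length bs"
  proof -
    have "card (set cs) = card (set bs)"
      using bs cs by (metis basis_list_def dim_eq_card)
    then show ?thesis
      using bs cs by (simp add: basis_list_def distinct_card)
  qed
  have lid: "Vector_Spaces.linear scale scale id" by (rule linear_id)
  let ?P = "matrix_wrt scale bs cs id" and ?Q = "matrix_wrt scale cs bs id"
  have "similar_mat (matrix_wrt scale cs cs f) (matrix_wrt scale bs bs f)"
  proof (rule similar_matI)
    show "{matrix_wrt scale cs cs f, matrix_wrt scale bs bs f, ?P, ?Q}
        \<subseteq> carrier_mat (length bs) (length bs)"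
      using len by (auto simp: matrix_wrt_def)
    show "?P * ?Q = 1\<^sub>m (length bs)"
      using matrix_wrt_comp[OF bs cs lid, of cs id] matrix_wrt_id[OF cs] len by simp
    show "?Q * ?P = 1\<^sub>m (length bs)"
      using matrix_wrt_comp[OF cs bs lid, of bs id] matrix_wrt_id[OF bs] by simp
    show "matrix_wrt scale cs cs f = ?P * matrix_wrt scale bs bs f * ?Q"
      using matrix_wrt_comp[OF bs cs lid, of bs f] matrix_wrt_comp[OF bs cs f, of cs id]
      by simp
  qed
  then show ?thesis
    unfolding char_polynomial_def cs_def[symmetric] Let_def by (rule char_poly_similar)
qed

end

end

theory Submission
  imports Defs
begin

text \<open>
Regard $V$ as a module over $K[s]$ with $s$ acting as $f$. The endomorphisms that commute with $f$
are the module endomorphisms, so a hyperinvariant subspace is a fully invariant submodule and a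
characteristic subspace is a submodule fixed by all module automorphisms. A submodule $X$ is marked
when it is compatible, in each generalized eigenspace, with some decomposition into cyclic
summands $C_0 \oplus \dots \oplus C_{k-1}$: then $X \cap V_\lambda$ is the direct sum of
submodules of the $C_i$.

A hyperinvariant $X$ is marked because the projections $\pi_i$ onto the summands of any cyclic
decomposition of $V_\lambda$, extended to $V$ by zero on an $f$-invariant complement of $V_\lambda$, commute
with $f$. They therefore map $X$ into itself, which splits $X \cap V_\lambda$ into the pieces
$X \cap C_i$; and every submodule of a nilpotent cyclic module is generated by a power of the
nilpotent map applied to the generator (\<open>cyclic_nilpotent_submodule\<close>). What this needs is the
existence of a cyclic decomposition (\<open>nilpotent_cyclic_decomposition\<close>) and of a projection
onto $V_\lambda$ that is a polynomial in $f$ (\<open>primary_projection\<close>).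

Conversely, let $X$ be characteristic and marked, let $g$ commute with $f$ and let $x \in X \cap
V_\lambda$. Write $x$ as a sum of $p_i \in X \cap C_i$, so that $g x$ is the sum of all
$\pi_j g p_i$. For $i = j$ the map $\pi_i g$ acts on the cyclic module $C_i$ as a polynomial,
and a polynomial in $f$ preserves $X$ (\<open>commuting_map_cyclic\<close>). For $i \neq j$ the map
$\eta = \pi_j g \pi_i$ has square zero, so $\iota + \eta$ is an automorphism with inverse
$\iota - \eta$, whence $\eta$ maps $X$ into $X$ (\<open>characteristic_square_zero\<close>). This argument
is valid over every field. It determines $g$ on all of $X$ because the characteristic polynomial
splits: by the Cayley-Hamilton theorem, $X$ is then the sum of the subspaces $X \cap V_\lambda$
(\<open>invariant_subspace_primary_decomposition\<close>).
\<close>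

section \<open>The action of polynomials\<close>

context
  fixes scale :: "'a::field \<Rightarrow> 'b::ab_group_add \<Rightarrow> 'b" (infixr \<open>*s\<close> 75)
begin

text \<open>The scalar multiplication of the \<open>K[s]\<close>-module in which \<open>s\<close> acts as \<open>h\<close>, evaluated by
  Horner's scheme so that induction on polynomials applies directly.\<close>

definition poly_act :: "('b \<Rightarrow> 'b) \<Rightarrow> 'a poly \<Rightarrow> 'b \<Rightarrow> 'b" where
  "poly_act h p = fold_coeffs (\<lambda>a g v. a *s v + h (g v)) p (\<lambda>_. 0)"

end

context vector_space
begin

lemma act_0 [simp]: "poly_act scale h 0 v = 0"
  by (simp add: poly_act_def)

lemma act_pCons:
  assumes "Vector_Spaces.linear scale scale h"
  shows "poly_act scale h (pCons a p) v = a *s v + h (poly_act scale h p v)"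
proof -
  interpret h: Vector_Spaces.linear scale scale h by fact
  show ?thesis
    by (cases "p = 0 \<and> a = 0") (auto simp: poly_act_def h.zero)
qed

lemma linearI:
  assumes "\<And>v w. g (v + w) = g v + g w" and "\<And>a v. g (a *s v) = a *s g v"
  shows "Vector_Spaces.linear scale scale g"
  using assms vector_space_axioms
  by (simp add: Vector_Spaces.linear_iff)

lemma linear_comp:
  assumes "Vector_Spaces.linear scale scale g" and "Vector_Spaces.linear scale scale h"
  shows "Vector_Spaces.linear scale scale (g \<circ> h)"
  using assms by (simp add: Vector_Spaces.linear_iff)

lemma linear_funpow:
  assumes "Vector_Spaces.linear scale scale h"
  shows "Vector_Spaces.linear scale scale (h ^^ i)"
  by (induction i) (use assms in \<open>auto intro: linear_comp[unfolded comp_def] simp: linear_ident comp_def id_def\<close>)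

context
  fixes h :: "'b \<Rightarrow> 'b"
  assumes h: "Vector_Spaces.linear scale scale h"
begin

interpretation h: Vector_Spaces.linear scale scale h
  by (fact h)

lemma act_linear: "Vector_Spaces.linear scale scale (poly_act scale h p)"
proof (rule linearI)
  show "poly_act scale h p (v + w) = poly_act scale h p v + poly_act scale h p w" for v w
    by (induction p) (auto simp: act_pCons[OF h] h.add scale_right_distrib)
  show "poly_act scale h p (a *s v) = a *s poly_act scale h p v" for a v
    by (induction p) (auto simp: act_pCons[OF h] h.scale scale_right_distrib mult.commute)
qed

lemma act_add_left: "poly_act scale h (p + q) v = poly_act scale h p v + poly_act scale h q v"
proof (induction p arbitrary: q)
  case (pCons a p)
  show ?case
  proof (cases q)
    case (pCons b q')
    show ?thesis
      unfolding pCons add_pCons act_pCons[OF h] pCons.IH h.add scale_left_distrib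
      by (simp only: add_ac)
  qed
qed simp

lemma act_smult: "poly_act scale h (Polynomial.smult a p) v = a *s poly_act scale h p v"
  by (induction p) (auto simp: act_pCons[OF h] h.scale scale_right_distrib)

lemma act_mult: "poly_act scale h (p * q) v = poly_act scale h p (poly_act scale h q v)"
  by (induction p) (auto simp: act_pCons[OF h] act_add_left act_smult h.zero)

lemma act_1 [simp]: "poly_act scale h 1 v = v"
  by (simp add: one_pCons act_pCons[OF h] h.zero)

lemma act_sum_left: "poly_act scale h (\<Sum>i\<in>I. p i) v = (\<Sum>i\<in>I. poly_act scale h (p i) v)"
  by (induction I rule: infinite_finite_induct) (auto simp: act_add_left)

lemma act_sum_right: "poly_act scale h p (\<Sum>i\<in>I. v i) = (\<Sum>i\<in>I. poly_act scale h p (v i))"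
proof -
  interpret p: Vector_Spaces.linear scale scale "poly_act scale h p" by (rule act_linear)
  show ?thesis by (rule p.sum)
qed

lemma act_zero_right [simp]: "poly_act scale h p 0 = 0"
  using act_sum_right[of p _ "{}"] by simp

lemma act_monom: "poly_act scale h (monom 1 i) v = (h ^^ i) v"
  by (induction i) (auto simp: act_pCons[OF h] monom_0 monom_Suc h.zero)

lemma act_linear_power: "poly_act scale h ([:- c, 1:] ^ n) v = (shifted scale h c ^^ n) v"
proof (induction n arbitrary: v)
  case (Suc n)
  have "poly_act scale h [:- c, 1:] w = shifted scale h c w" for w
    by (simp add: act_pCons[OF h] shifted_def h.zero)
  then show ?case
    by (simp add: act_mult Suc.IH del: mult_pCons_left)
qed simp

lemma act_commute:
  assumes "Vector_Spaces.linear scale scale g" and "g \<circ> h = h \<circ> g"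
  shows "g (poly_act scale h p v) = poly_act scale h p (g v)"
proof -
  interpret g: Vector_Spaces.linear scale scale g by fact
  show ?thesis
    by (induction p)
       (use assms(2) in \<open>auto simp: act_pCons[OF h] g.add g.scale g.zero fun_eq_iff\<close>)
qed

lemma act_invariant:
  assumes "subspace X" and "h ` X \<subseteq> X" and "v \<in> X"
  shows "poly_act scale h p v \<in> X"
  using assms
  by (induction p) (auto simp: act_pCons[OF h] subspace_0 intro!: subspace_add subspace_scale)

lemma cyclic_subspace_eq_act: "cyclic_subspace scale h u = range (\<lambda>p. poly_act scale h p u)"
proof
  have "subspace (range (\<lambda>p. poly_act scale h p u))"
    by (rule subspaceI)
       (auto simp flip: act_add_left act_smult intro: range_eqI[of _ _ 0])
  then show "cyclic_subspace scale h u \<subseteq> range (\<lambda>p. poly_act scale h p u)"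
    unfolding cyclic_subspace_def
    by (intro span_minimal) (auto simp flip: act_monom)
  have "poly_act scale h p ((h ^^ i) u) \<in> cyclic_subspace scale h u" for i p
  proof (induction p arbitrary: i)
    case (pCons a p)
    have "h (poly_act scale h p ((h ^^ i) u)) = poly_act scale h p ((h ^^ Suc i) u)"
      using act_commute[OF h refl] by simp
    then show ?case
      using pCons.IH[of "Suc i"] unfolding act_pCons[OF h] cyclic_subspace_def
      by (auto intro!: span_add span_scale intro: span_base)
  qed (simp add: cyclic_subspace_def span_zero)
  from this[of _ 0] show "range (\<lambda>p. poly_act scale h p u) \<subseteq> cyclic_subspace scale h u"
    by auto
qed

lemma subspace_cyclic: "subspace (cyclic_subspace scale h u)"
  by (simp add: cyclic_subspace_def)

lemma cyclic_subspace_invariant: "h ` cyclic_subspace scale h u \<subseteq> cyclic_subspace scale h u"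
proof -
  have "h (poly_act scale h p u) = poly_act scale h (pCons 0 p) u" for p
    by (simp add: act_pCons[OF h])
  then show ?thesis
    unfolding cyclic_subspace_eq_act by auto
qed

lemma generator_in_cyclic: "(h ^^ i) u \<in> cyclic_subspace scale h u"
  unfolding cyclic_subspace_eq_act by (auto simp flip: act_monom)

lemma cyclic_subspace_minimal:
  assumes "subspace X" and "h ` X \<subseteq> X" and "u \<in> X"
  shows "cyclic_subspace scale h u \<subseteq> X"
  unfolding cyclic_subspace_eq_act using act_invariant[OF assms] by auto

text \<open>On a cyclic module over a commutative ring every endomorphism is multiplication by a scalar: if
  \<open>g u = q u\<close>, then \<open>g (p u) = p (q u) = q (p u)\<close>. Hence it preserves every submodule.\<close>

lemma commuting_map_cyclic:
  assumes g: "Vector_Spaces.linear scale scale g" "g \<circ> h = h \<circ> g"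
    and gu: "g u \<in> cyclic_subspace scale h u"
    and X: "subspace X" "h ` X \<subseteq> X" and x: "x \<in> X" "x \<in> cyclic_subspace scale h u"
  shows "g x \<in> X"
proof -
  obtain q where q: "g u = poly_act scale h q u"
    using gu unfolding cyclic_subspace_eq_act by auto
  obtain p where p: "x = poly_act scale h p u"
    using x(2) unfolding cyclic_subspace_eq_act by auto
  have "g x = poly_act scale h p (poly_act scale h q u)"
    using act_commute[OF g] p q by simp
  also have "\<dots> = poly_act scale h q x"
    unfolding p by (simp flip: act_mult add: mult.commute)
  finally show ?thesis
    using act_invariant[OF X x(1)] by simp
qed

end

section \<open>The Cayley-Hamilton theorem\<close>

text \<open>The columns of \<open>char_poly_matrix A\<close> are relations between the basis vectors in the
  \<open>K[s]\<close>-module \<open>V\<close>. Combining them with the entries of the adjugate matrix as coefficients leaves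
  the determinant acting on a single basis vector.\<close>

theorem char_polynomial_annihilates:
  assumes bs: "basis_list scale bs" and f: "Vector_Spaces.linear scale scale f"
  shows "poly_act scale f (char_polynomial scale f) v = 0"
proof -
  interpret f: Vector_Spaces.linear scale scale f by (fact f)
  define A where "A = matrix_wrt scale bs bs f"
  define n where "n = length bs"
  define M where "M = char_poly_matrix A"
  have A: "A \<in> carrier_mat n n"
    by (simp add: A_def n_def matrix_wrt_def)
  then have M: "M \<in> carrier_mat n n"
    by (simp add: M_def)
  note B = adj_mat[OF M]
  have rel: "(\<Sum>i<n. poly_act scale f (M $$ (i, j)) (bs ! i)) = 0" if j: "j < n" for j
  proof -
    have "poly_act scale f (M $$ (i, j)) (bs ! i)
        = (if i = j then f (bs ! j) else 0) - A $$ (i, j) *s (bs ! i)" if "i < n" for i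
      using that j A
      by (auto simp: M_def char_poly_matrix_def act_pCons[OF f] act_1[OF f] act_add_left[OF f] f.zero)
    then have "(\<Sum>i<n. poly_act scale f (M $$ (i, j)) (bs ! i))
        = f (bs ! j) - (\<Sum>i<n. A $$ (i, j) *s (bs ! i))"
      using j by (simp add: sum_subtractf sum.delta)
    also have "(\<Sum>i<n. A $$ (i, j) *s (bs ! i)) = f (bs ! j)"
      using basis_list_coordinates[OF bs, of "f (bs ! j)"] j
      by (simp add: A_def n_def matrix_wrt_def)
    finally show ?thesis by simp
  qed
  have kill: "poly_act scale f (det M) (bs ! k) = 0" if k: "k < n" for k
  proof -
    have entry: "(M * adj_mat M) $$ (i, k) = (\<Sum>j<n. adj_mat M $$ (j, k) * M $$ (i, j))"
      if "i < n" for i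
      using that k M B(1) by (simp add: scalar_prod_def atLeast0LessThan mult.commute)
    have "0 = (\<Sum>j<n. poly_act scale f (adj_mat M $$ (j, k)) (\<Sum>i<n. poly_act scale f (M $$ (i, j)) (bs ! i)))"
      by (simp add: rel act_zero_right[OF f])
    also have "\<dots> = (\<Sum>i<n. \<Sum>j<n. poly_act scale f (adj_mat M $$ (j, k) * M $$ (i, j)) (bs ! i))"
      unfolding act_sum_right[OF f] act_mult[OF f] by (rule sum.swap)
    also have "\<dots> = (\<Sum>i<n. poly_act scale f ((M * adj_mat M) $$ (i, k)) (bs ! i))"
      by (simp add: entry act_sum_left[OF f])
    also have "\<dots> = (\<Sum>i<n. if i = k then poly_act scale f (det M) (bs ! k) else 0)"
      using k by (intro sum.cong) (auto simp: B(2))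
    finally show ?thesis
      using k by (simp add: sum.delta)
  qed
  interpret d: Vector_Spaces.linear scale scale "poly_act scale f (det M)"
    by (rule act_linear[OF f])
  have "poly_act scale f (det M) v = 0"
  proof -
    have "poly_act scale f (det M) (\<Sum>k<n. representation (set bs) v (bs ! k) *s bs ! k) = 0"
      by (simp add: d.sum d.scale kill)
    then show ?thesis
      by (simp only: n_def basis_list_coordinates[OF bs])
  qed
  then show ?thesis
    by (simp add: char_polynomial_eq[OF bs f] char_poly_def M_def A_def)
qed

end

section \<open>Primary decomposition\<close>

text \<open>After scaling, \<open>q = 1 - x\<close> with \<open>x\<close> a multiple of \<open>s - c\<close>, and the finite geometric series
  inverts \<open>1 - x\<close> modulo \<open>x ^ n\<close>.\<close>

lemma linear_power_bezout:
  fixes q :: "'a::field poly"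
  assumes "poly q c \<noteq> 0"
  shows "\<exists>a b. a * [:- c, 1:] ^ n + b * q = 1"
proof -
  define L where "L = [:- c, 1:]"
  let ?d = "poly q c"
  have "L dvd 1 - Polynomial.smult (1 / ?d) q"
    using assms unfolding L_def by (simp add: poly_eq_0_iff_dvd[symmetric])
  then obtain s where s: "1 - Polynomial.smult (1 / ?d) q = L * s"
    by (elim dvdE)
  then have q: "Polynomial.smult (1 / ?d) q = 1 - L * s"
    by (simp add: algebra_simps)
  define g where "g = (\<Sum>i<n. (L * s) ^ i)"
  have "s ^ n * L ^ n + Polynomial.smult (1 / ?d) g * q
      = (L * s) ^ n + Polynomial.smult (1 / ?d) q * g"
    by (simp add: power_mult_distrib mult.commute)
  also have "\<dots> = 1"
    unfolding q g_def one_diff_power_eq[symmetric] by simp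
  finally show ?thesis
    unfolding L_def by blast
qed

text \<open>Replaces multiplicities by a common bound, which allows an induction over the set of distinct
  roots instead of the list of roots.\<close>

lemma prod_list_dvd_prod_power:
  fixes g :: "'a \<Rightarrow> 'b::comm_semiring_1"
  shows "(\<Prod>a\<leftarrow>as. g a) dvd (\<Prod>a\<in>set as. g a ^ length as)"
proof (induction as)
  case (Cons b as)
  let ?m = "length as"
  have "g b * (\<Prod>a\<leftarrow>as. g a) dvd g b * (\<Prod>a\<in>set as. g a ^ ?m)"
    by (rule mult_dvd_mono[OF dvd_refl Cons.IH])
  also have "\<dots> dvd (\<Prod>a\<in>set (b # as). g a) * (\<Prod>a\<in>set (b # as). g a ^ ?m)"
    by (intro mult_dvd_mono dvd_prodI prod_dvd_prod_subset) auto
  also have "\<dots> = (\<Prod>a\<in>set (b # as). g a ^ length (b # as))"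
    by (simp only: prod.distrib[symmetric] list.size power_Suc add_0_right add_Suc_right One_nat_def)
  finally show ?case by simp
qed simp

context vector_space
begin

lemma shifted_linear:
  assumes "Vector_Spaces.linear scale scale f"
  shows "Vector_Spaces.linear scale scale (shifted scale f c)"
proof -
  interpret f: Vector_Spaces.linear scale scale f by fact
  show ?thesis
    by (rule linearI)
       (auto simp: shifted_def f.add f.scale scale_right_distrib scale_right_diff_distrib mult.commute)
qed

lemma shifted_commute:
  assumes "Vector_Spaces.linear scale scale g" and "g \<circ> f = f \<circ> g"
  shows "g \<circ> shifted scale f c = shifted scale f c \<circ> g"
proof -
  interpret g: Vector_Spaces.linear scale scale g by fact
  show ?thesis
    using assms(2) by (auto simp: fun_eq_iff shifted_def g.diff g.scale)
qed

text \<open>Passing between \<open>f\<close> and \<open>f - c\<close> does not change the invariant subspaces, so that statements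
  about nilpotent maps can be applied to \<open>f - c\<close> on a generalized eigenspace.\<close>

lemma invariant_shifted_iff:
  assumes "subspace X"
  shows "shifted scale f c ` X \<subseteq> X \<longleftrightarrow> f ` X \<subseteq> X"
proof -
  have "f x - c *s x \<in> X \<longleftrightarrow> f x \<in> X" if "x \<in> X" for x
    using subspace_add[OF assms, of "f x - c *s x" "c *s x"] subspace_diff[OF assms, of "f x" "c *s x"]
      subspace_scale[OF assms that, of c] by auto
  then show ?thesis
    by (auto simp: shifted_def)
qed

lemma gen_eigenspace_subspace:
  assumes "Vector_Spaces.linear scale scale f"
  shows "subspace (gen_eigenspace scale f c)"
proof -
  interpret h: Vector_Spaces.linear scale scale "shifted scale f c ^^ dim UNIV"
    by (intro linear_funpow shifted_linear assms)
  show ?thesis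
    unfolding gen_eigenspace_def by (rule h.subspace_kernel)
qed

lemma gen_eigenspace_hyperinvariant:
  assumes f: "Vector_Spaces.linear scale scale f" and g: "g \<in> End_comm scale f"
    and v: "v \<in> gen_eigenspace scale f c"
  shows "g v \<in> gen_eigenspace scale f c"
proof -
  have lin: "Vector_Spaces.linear scale scale g" and com: "g \<circ> f = f \<circ> g"
    using g by (auto simp: End_comm_def)
  interpret g: Vector_Spaces.linear scale scale g by (fact lin)
  have "g (poly_act scale f p v) = poly_act scale f p (g v)" for p
    by (rule act_commute[OF f lin com])
  from this[of "[:- c, 1:] ^ dim UNIV"] show ?thesis
    using v by (simp add: gen_eigenspace_def act_linear_power[OF f] g.zero)
qed

lemma End_comm_self:
  "Vector_Spaces.linear scale scale f \<Longrightarrow> f \<in> End_comm scale f"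
  by (simp add: End_comm_def)

lemma End_comm_poly_act:
  assumes "Vector_Spaces.linear scale scale f"
  shows "poly_act scale f p \<in> End_comm scale f"
  using act_commute[OF assms assms refl] act_linear[OF assms]
  by (auto simp: End_comm_def fun_eq_iff)

lemma End_comm_comp:
  "g \<in> End_comm scale f \<Longrightarrow> g' \<in> End_comm scale f \<Longrightarrow> g \<circ> g' \<in> End_comm scale f"
  by (auto simp: End_comm_def fun_eq_iff intro: linear_comp)

lemma gen_eigenspace_trivial:
  assumes f: "Vector_Spaces.linear scale scale f" and "\<not> is_eigenvalue scale f c"
  shows "gen_eigenspace scale f c = {0}"
proof -
  have "v = 0" if "(shifted scale f c ^^ n) v = 0" for n v
    using that
  proof (induction n)
    case (Suc n)
    then show ?case
      using assms(2) by (auto simp: is_eigenvalue_def shifted_def)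
  qed simp
  then show ?thesis
    using subspace_0[OF gen_eigenspace_subspace[OF f]] by (auto simp: gen_eigenspace_def)
qed

end

context finite_dimensional_vector_space
begin

lemma basis_list_exists: "\<exists>bs. basis_list scale bs \<and> length bs = dim UNIV"
proof -
  obtain bs where bs: "set bs = Basis" "distinct bs"
    using finite_distinct_list[OF finite_Basis] by blast
  then have "length bs = dim UNIV"
    by (metis dim_UNIV distinct_card)
  then show ?thesis
    using bs independent_Basis span_Basis by (auto simp: basis_list_def)
qed

lemma char_polynomial_degree:
  assumes f: "Vector_Spaces.linear scale scale f"
  shows "degree (char_polynomial scale f) = dim UNIV" and "char_polynomial scale f \<noteq> 0"
proof -
  obtain bs where bs: "basis_list scale bs" "length bs = dim UNIV"
    using basis_list_exists by blast
  have "matrix_wrt scale bs bs f \<in> carrier_mat (dim UNIV) (dim UNIV)"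
    using bs(2) by (simp add: matrix_wrt_def)
  from degree_monic_char_poly[OF this]
  show "degree (char_polynomial scale f) = dim UNIV" and "char_polynomial scale f \<noteq> 0"
    by (auto simp: char_polynomial_eq[OF bs(1) f])
qed

text \<open>Write the characteristic polynomial as \<open>(s - c) ^ m * q\<close> with \<open>q\<close> prime to \<open>s - c\<close>, and
  \<open>a (s - c) ^ n + b q = 1\<close>. Then \<open>b q\<close> acts as the identity on the kernel of \<open>(f - c) ^ n\<close>, and its
  image lies in this kernel because \<open>(s - c) ^ n q\<close> is a multiple of the characteristic polynomial.
  As a polynomial in \<open>f\<close>, the projection commutes with \<open>f\<close>.\<close>

lemma primary_projection:
  assumes f: "Vector_Spaces.linear scale scale f"
  obtains e where "\<And>v. poly_act scale f e v \<in> gen_eigenspace scale f c"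
    and "\<And>v. v \<in> gen_eigenspace scale f c \<Longrightarrow> poly_act scale f e v = v"
proof -
  let ?n = "dim UNIV" and ?chi = "char_polynomial scale f"
  define L where "L = [:- c, 1:]"
  obtain q where q: "?chi = L ^ order c ?chi * q" "\<not> L dvd q"
    using order_decomp[OF char_polynomial_degree(2)[OF f]] unfolding L_def by blast
  have le: "order c ?chi \<le> ?n"
    using order_degree[OF char_polynomial_degree(2)[OF f]] char_polynomial_degree(1)[OF f] by metis
  obtain a b where ab: "a * L ^ ?n + b * q = 1"
    using linear_power_bezout[of q c ?n] q(2) by (auto simp: poly_eq_0_iff_dvd L_def)
  obtain bs where bs: "basis_list scale bs"
    using basis_list_exists by blast
  show ?thesis
  proof
    fix v
    have "L ^ ?n * (b * q) = b * L ^ (?n - order c ?chi) * (L ^ order c ?chi * q)"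
      using le by (simp add: mult_ac flip: power_add)
    then have "L ^ ?n * (b * q) = b * L ^ (?n - order c ?chi) * ?chi"
      by (simp only: flip: q(1))
    then have "poly_act scale f (L ^ ?n * (b * q)) v = 0"
      by (simp only: act_mult[OF f] char_polynomial_annihilates[OF bs f] act_zero_right[OF f])
    then show "poly_act scale f (b * q) v \<in> gen_eigenspace scale f c"
      by (simp only: L_def gen_eigenspace_def act_mult[OF f] act_linear_power[OF f] mem_Collect_eq)
  next
    fix v
    assume "v \<in> gen_eigenspace scale f c"
    then have "poly_act scale f (a * L ^ ?n) v = 0"
      by (simp add: L_def gen_eigenspace_def act_mult[OF f] act_linear_power[OF f] act_zero_right[OF f])
    then have "poly_act scale f (a * L ^ ?n + b * q) v = poly_act scale f (b * q) v"
      by (simp only: act_add_left[OF f] add_0)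
    then show "poly_act scale f (b * q) v = v"
      by (simp only: ab act_1[OF f])
  qed
qed

text \<open>A vector killed by \<open>(s - c) ^ n q\<close>, with \<open>q\<close> prime to \<open>s - c\<close>, is the sum of one killed by
  \<open>q\<close> and one killed by \<open>(s - c) ^ n\<close>. Both are obtained from it by polynomials in \<open>f\<close> and so stay
  in \<open>X\<close>. The roots are split off one at a time.\<close>

theorem invariant_subspace_primary_decomposition:
  assumes f: "Vector_Spaces.linear scale scale f" and split: "char_polynomial_splits scale f"
    and X: "subspace X" "f ` X \<subseteq> X"
  shows "X \<subseteq> span (\<Union>c. X \<inter> gen_eigenspace scale f c)"
proof -
  let ?n = "dim UNIV" 
  define L where "L = (\<lambda>c::'a. [:- c, 1:])"
  obtain as where as: "char_polynomial scale f = (\<Prod>a\<leftarrow>as. L a)"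
    using split by (auto simp: char_polynomial_splits_def L_def)
  have "degree (\<Prod>a\<leftarrow>as. L a) = length as"
    by (simp add: L_def degree_linear_factors)
  then have len: "length as = ?n"
    using char_polynomial_degree(1)[OF f] by (simp only: as)
  obtain bs where bs: "basis_list scale bs"
    using basis_list_exists by blast
  have *: "x \<in> span (\<Union>c. X \<inter> gen_eigenspace scale f c)"
    if "finite S" "x \<in> X" "poly_act scale f (\<Prod>a\<in>S. L a ^ ?n) x = 0" for S x
    using that
  proof (induction S arbitrary: x rule: finite_induct)
    case empty
    then show ?case by (simp add: act_1[OF f] span_zero)
  next
    case (insert c S)
    let ?q = "\<Prod>a\<in>S. L a ^ ?n"
    have "poly ?q c \<noteq> 0"
      using insert.hyps by (auto simp: poly_prod L_def)
    then obtain a b where ab: "a * L c ^ ?n + b * ?q = 1"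
      using linear_power_bezout[of ?q c ?n] unfolding L_def by blast
    define y z where "y = poly_act scale f (a * L c ^ ?n) x" and "z = poly_act scale f (b * ?q) x"
    have prod: "poly_act scale f (?q * L c ^ ?n) x = 0"
      using insert.prems(2) insert.hyps by (simp add: mult.commute)
    have mem: "y \<in> X" "z \<in> X"
      unfolding y_def z_def by (rule act_invariant[OF f X insert.prems(1)])+
    have "poly_act scale f ?q y = poly_act scale f (a * (?q * L c ^ ?n)) x"
      unfolding y_def by (simp only: mult_ac flip: act_mult[OF f])
    also have "\<dots> = 0"
      unfolding act_mult[OF f, of a] prod by (rule act_zero_right[OF f])
    finally have y: "y \<in> span (\<Union>c. X \<inter> gen_eigenspace scale f c)"
      by (rule insert.IH[OF mem(1)])
    have "poly_act scale f (L c ^ ?n) z = poly_act scale f (b * (?q * L c ^ ?n)) x"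
      unfolding z_def by (simp only: mult_ac flip: act_mult[OF f])
    also have "\<dots> = 0"
      unfolding act_mult[OF f, of b] prod by (rule act_zero_right[OF f])
    finally have "z \<in> gen_eigenspace scale f c"
      by (simp add: L_def gen_eigenspace_def act_linear_power[OF f])
    with mem(2) have z: "z \<in> span (\<Union>c. X \<inter> gen_eigenspace scale f c)"
      by (intro span_base) blast
    have "x = y + z"
      unfolding y_def z_def act_add_left[OF f, symmetric] ab by (simp add: act_1[OF f])
    then show ?case
      using span_add[OF y z] by simp
  qed
  have "(\<Prod>a\<leftarrow>as. L a) dvd (\<Prod>a\<in>set as. L a ^ length as)"
    by (rule prod_list_dvd_prod_power)
  then obtain r where "(\<Prod>a\<in>set as. L a ^ ?n) = char_polynomial scale f * r"
    unfolding as len by (elim dvdE)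
  then have "poly_act scale f (\<Prod>a\<in>set as. L a ^ ?n) x = 0" for x
    by (simp only: act_mult[OF f] char_polynomial_annihilates[OF bs f])
  then show ?thesis
    using *[of "set as"] by auto
qed

end

section \<open>Direct sums and their projections\<close>

context vector_space
begin

lemma direct_sum_components_unique:
  assumes ds: "internal_direct_sum k A W" and A: "\<And>i. i < k \<Longrightarrow> subspace (A i)"
    and a: "\<And>i. i < k \<Longrightarrow> a i \<in> A i" and b: "\<And>i. i < k \<Longrightarrow> b i \<in> A i"
    and eq: "(\<Sum>i<k. a i) = (\<Sum>i<k. b i)" and i: "i < k"
  shows "a i = b i"
proof -
  have zero: "(\<forall>i<k. a i - b i \<in> A i) \<and> (\<Sum>i<k. a i - b i) = 0"
    using A a b eq by (simp add: sum_subtractf subspace_diff)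
  have all: "\<forall>c. (\<forall>i<k. c i \<in> A i) \<and> (\<Sum>i<k. c i) = 0 \<longrightarrow> (\<forall>i<k. c i = 0)"
    using ds unfolding internal_direct_sum_def by (rule conjunct2)
  show ?thesis
    using mp[OF spec[OF all, of "\<lambda>i. a i - b i"] zero] i by simp
qed

lemma direct_sum_summand:
  assumes ds: "internal_direct_sum k A W" and A: "\<And>i. i < k \<Longrightarrow> subspace (A i)" and i: "i < k"
  shows "A i \<subseteq> W"
proof
  fix x
  assume "x \<in> A i"
  then have "\<forall>j<k. (if j = i then x else 0) \<in> A j"
    using A by (simp add: subspace_0)
  moreover have "x = (\<Sum>j<k. if j = i then x else 0)"
    using i by (simp add: sum.delta)
  ultimately have "x \<in> {\<Sum>i<k. a i |a. \<forall>i<k. a i \<in> A i}"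
    by (intro CollectI exI[of _ "\<lambda>j. if j = i then x else 0"] conjI)
  then show "x \<in> W"
    using ds by (simp only: internal_direct_sum_def)
qed

text \<open>The projection \<open>E\<close> onto \<open>W\<close> makes it possible to define the component maps on all of \<open>V\<close>, where
  they are linear and commute with \<open>f\<close> by the uniqueness of components.\<close>

lemma direct_sum_projections:
  assumes ds: "internal_direct_sum k A W"
    and A: "\<And>i. i < k \<Longrightarrow> subspace (A i)" and inv: "\<And>i. i < k \<Longrightarrow> f ` A i \<subseteq> A i"
    and f: "Vector_Spaces.linear scale scale f" and E: "E \<in> End_comm scale f"
    and EW: "\<And>v. E v \<in> W" and Eid: "\<And>w. w \<in> W \<Longrightarrow> E w = w"
  obtains \<pi> where "\<And>i. i < k \<Longrightarrow> \<pi> i \<in> End_comm scale f"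
    and "\<And>i v. i < k \<Longrightarrow> \<pi> i v \<in> A i"
    and "\<And>w. w \<in> W \<Longrightarrow> (\<Sum>i<k. \<pi> i w) = w"
    and "\<And>i x. i < k \<Longrightarrow> x \<in> A i \<Longrightarrow> \<pi> i x = x"
    and "\<And>i j x. i < k \<Longrightarrow> j < k \<Longrightarrow> i \<noteq> j \<Longrightarrow> x \<in> A j \<Longrightarrow> \<pi> i x = 0"
proof -
  have Elin: "Vector_Spaces.linear scale scale E" and Ecom: "E \<circ> f = f \<circ> E"
    using E by (auto simp: End_comm_def)
  interpret f: Vector_Spaces.linear scale scale f by (fact f)
  interpret E: Vector_Spaces.linear scale scale E by (fact Elin)
  have "\<forall>v. \<exists>a. (\<forall>i<k. a i \<in> A i) \<and> (\<Sum>i<k. a i) = E v"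
  proof
    fix v
    have "E v \<in> {\<Sum>i<k. a i |a. \<forall>i<k. a i \<in> A i}"
      using ds EW[of v] by (simp add: internal_direct_sum_def)
    then show "\<exists>a. (\<forall>i<k. a i \<in> A i) \<and> (\<Sum>i<k. a i) = E v"
      by auto
  qed
  then obtain d where d: "\<forall>v. (\<forall>i<k. d v i \<in> A i) \<and> (\<Sum>i<k. d v i) = E v"
    by metis
  define \<pi> where "\<pi> = (\<lambda>i v. d v i)"
  have mem: "\<pi> i v \<in> A i" if "i < k" for i v
    using d that by (simp add: \<pi>_def)
  have sum: "(\<Sum>i<k. \<pi> i v) = E v" for v
    using d by (simp add: \<pi>_def)
  have unique: "\<pi> i v = a i" if "\<And>i. i < k \<Longrightarrow> a i \<in> A i" "(\<Sum>i<k. a i) = E v" "i < k" for i v a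
    by (rule direct_sum_components_unique[OF ds A]) (use that mem sum in auto)
  have lin: "Vector_Spaces.linear scale scale (\<pi> i)" if "i < k" for i
  proof (rule linearI)
    show "\<pi> i (v + w) = \<pi> i v + \<pi> i w" for v w
      by (rule unique)
         (use that mem sum A in \<open>auto simp: sum.distrib E.add intro: subspace_add\<close>)
    show "\<pi> i (a *s v) = a *s \<pi> i v" for a v
      by (rule unique)
         (use that mem sum A in \<open>auto simp: scale_sum_right[symmetric] E.scale intro: subspace_scale\<close>)
  qed
  have com: "\<pi> i (f v) = f (\<pi> i v)" if "i < k" for i v
    by (rule unique)
       (use that mem sum inv Ecom in \<open>auto simp: f.sum[symmetric] fun_eq_iff image_subset_iff\<close>)
  have fixed: "E x = x" if "j < k" "x \<in> A j" for j x
    using direct_sum_summand[OF ds A that(1)] that(2) by (intro Eid) blast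
  have fixed: "E x = x" if "j < k" "x \<in> A j" for j x
    using direct_sum_summand[OF ds A that(1)] that(2) by (intro Eid) blast
  have comp: "\<pi> i x = (if i = j then x else 0)" if "i < k" "j < k" "x \<in> A j" for i j x
    by (rule unique)
       (use that A fixed[OF that(2,3)] in \<open>auto simp: sum.delta subspace_0\<close>)
  show ?thesis
  proof
    show "\<pi> i \<in> End_comm scale f" if "i < k" for i
      using lin com that by (auto simp: End_comm_def)
  qed (use mem sum Eid comp in auto)
qed

lemma direct_sum_Suc:
  assumes Z: "internal_direct_sum k A Z" "subspace Z"
    and sub: "Z \<subseteq> W" "A k \<subseteq> W" "subspace W" "subspace (A k)"
    and int: "A k \<inter> Z \<subseteq> {0}" and ex: "\<And>w. w \<in> W \<Longrightarrow> \<exists>p\<in>A k. w - p \<in> Z"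
  shows "internal_direct_sum (Suc k) A W"
proof -
  have Zeq: "Z = {\<Sum>i<k. a i |a. \<forall>i<k. a i \<in> A i}"
    and Zuniq: "\<And>a. (\<forall>i<k. a i \<in> A i) \<Longrightarrow> (\<Sum>i<k. a i) = 0 \<Longrightarrow> \<forall>i<k. a i = 0"
    using Z(1) unfolding internal_direct_sum_def by blast+
  have dec: "\<exists>a. w = (\<Sum>i<Suc k. a i) \<and> (\<forall>i<Suc k. a i \<in> A i)" if w: "w \<in> W" for w
  proof -
    obtain p where p: "p \<in> A k" "w - p \<in> Z"
      using ex[OF w] by blast
    then obtain a where a: "w - p = (\<Sum>i<k. a i)" "\<forall>i<k. a i \<in> A i"
      using Zeq by auto
    have "w = (\<Sum>i<k. a i) + p"
      using a(1) by (simp add: algebra_simps)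
    then show ?thesis
      using a(2) p(1) by (intro exI[of _ "a(k := p)"]) (simp add: less_Suc_eq)
  qed
  have mem: "(\<Sum>i<Suc k. a i) \<in> W" if "\<forall>i<Suc k. a i \<in> A i" for a
  proof -
    have "(\<Sum>i<k. a i) \<in> Z"
      using that Zeq by auto
    then show ?thesis
      using that sub by (auto intro!: subspace_add)
  qed
  have uniq: "\<forall>i<Suc k. a i = 0" if "\<forall>i<Suc k. a i \<in> A i" "(\<Sum>i<Suc k. a i) = 0" for a
  proof -
    have s: "(\<Sum>i<k. a i) \<in> Z"
      using that(1) Zeq by auto
    have "a k = - (\<Sum>i<k. a i)"
      using that(2) by (simp add: eq_neg_iff_add_eq_0 add.commute)
    then have "a k \<in> Z"
      using subspace_neg[OF Z(2) s] by simp
    moreover have "a k \<in> A k"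
      using that(1) by blast
    ultimately have ak: "a k = 0"
      using int by blast
    have "\<forall>i<k. a i \<in> A i" and "(\<Sum>i<k. a i) = 0"
      using that ak by simp_all
    then have "\<forall>i<k. a i = 0"
      by (rule Zuniq)
    with ak show ?thesis
      by (simp add: less_Suc_eq)
  qed
  show ?thesis
    unfolding internal_direct_sum_def
  proof (intro conjI allI impI)
    show "W = {\<Sum>i<Suc k. a i |a. \<forall>i<Suc k. a i \<in> A i}"
    proof (intro subset_antisym subsetI)
      show "x \<in> W" if "x \<in> {\<Sum>i<Suc k. a i |a. \<forall>i<Suc k. a i \<in> A i}" for x
        using that mem by (elim CollectE exE conjE) (simp only:)
      show "x \<in> {\<Sum>i<Suc k. a i |a. \<forall>i<Suc k. a i \<in> A i}" if "x \<in> W" for x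
        using dec[OF that] by (rule CollectI)
    qed
    show "a i = 0" if "(\<forall>i<Suc k. a i \<in> A i) \<and> (\<Sum>i<Suc k. a i) = 0" "i < Suc k" for a i
      using uniq[of a] that by blast
  qed
qed

lemma internal_direct_sum_cong:
  assumes "\<And>i. i < k \<Longrightarrow> A i = B i"
  shows "internal_direct_sum k A W \<longleftrightarrow> internal_direct_sum k B W"
  using assms unfolding internal_direct_sum_def by simp

section \<open>Cyclic modules of a nilpotent map\<close>

lemma funpow_zero_mono:
  assumes h: "Vector_Spaces.linear scale scale h" and "(h ^^ t) u = 0" and "t \<le> m"
  shows "(h ^^ m) u = 0"
proof -
  interpret p: Vector_Spaces.linear scale scale "h ^^ (m - t)"
    by (rule linear_funpow[OF h])
  have "(h ^^ m) u = (h ^^ (m - t)) ((h ^^ t) u)"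
    using assms(3) by (metis comp_apply funpow_add le_add_diff_inverse2)
  then show ?thesis
    using assms(2) p.zero by simp
qed

text \<open>Factor \<open>x = p u\<close> as \<open>p = s ^ m q\<close> with \<open>q\<close> prime to \<open>s\<close>. Modulo \<open>s ^ t\<close> the factor \<open>q\<close> is a
  unit, so \<open>x\<close> and \<open>s ^ m u\<close> generate the same submodule.\<close>

lemma nilpotent_cyclic_associate:
  assumes h: "Vector_Spaces.linear scale scale h" and t: "(h ^^ t) u = 0"
    and x: "x \<in> cyclic_subspace scale h u" "x \<noteq> 0"
  shows "\<exists>m<t. x \<in> cyclic_subspace scale h ((h ^^ m) u) \<and> (h ^^ m) u \<in> cyclic_subspace scale h x"
proof -
  obtain p where p: "x = poly_act scale h p u"
    using x(1) unfolding cyclic_subspace_eq_act[OF h] by auto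
  define s where "s = [:- (0::'a), 1:]"
  have s: "poly_act scale h (s ^ i) v = (h ^^ i) v" for i v
    unfolding s_def act_linear_power[OF h] by (simp add: shifted_def)
  have "p \<noteq> 0"
    using p x(2) by auto
  then obtain q where q: "p = s ^ order 0 p * q" "\<not> s dvd q"
    using order_decomp[of p 0] unfolding s_def by blast
  let ?m = "order 0 p"
  have xq: "x = poly_act scale h q ((h ^^ ?m) u)"
  proof -
    have "x = poly_act scale h (q * s ^ ?m) u"
      unfolding p by (subst q(1)) (simp only: mult.commute)
    then show ?thesis
      by (simp only: act_mult[OF h] s)
  qed
  obtain a b where ab: "a * s ^ t + b * q = 1"
    using linear_power_bezout[of q 0 t] q(2) by (auto simp: poly_eq_0_iff_dvd s_def)
  have "?m < t"
    using xq x(2) funpow_zero_mono[OF h t, of ?m] act_zero_right[OF h] by (metis not_le)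
  moreover have "x \<in> cyclic_subspace scale h ((h ^^ ?m) u)"
    unfolding cyclic_subspace_eq_act[OF h] using xq by blast
  moreover have "(h ^^ ?m) u = poly_act scale h b x"
  proof -
    have "(h ^^ t) ((h ^^ ?m) u) = 0"
      using funpow_zero_mono[OF h t, of "t + ?m"] by (simp add: funpow_add)
    then have "poly_act scale h (a * s ^ t + b * q) ((h ^^ ?m) u) = poly_act scale h b x"
      unfolding act_add_left[OF h] act_mult[OF h] s xq[symmetric] by (simp add: act_zero_right[OF h])
    then show ?thesis
      by (simp only: ab act_1[OF h])
  qed
  ultimately show ?thesis
    unfolding cyclic_subspace_eq_act[OF h, of x] by blast
qed

text \<open>Every \<open>y\<close> in \<open>Y\<close> generates the same submodule as some \<open>(h ^^ m) u\<close>, which then lies in \<open>Y\<close> as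
  well. So \<open>Y\<close> is generated by the lowest power of \<open>h\<close> that takes \<open>u\<close> into \<open>Y\<close>.\<close>

lemma cyclic_nilpotent_submodule:
  assumes h: "Vector_Spaces.linear scale scale h" and t: "(h ^^ t) u = 0"
    and Y: "subspace Y" "h ` Y \<subseteq> Y" "Y \<subseteq> cyclic_subspace scale h u"
  shows "\<exists>r\<le>t. Y = cyclic_subspace scale h ((h ^^ r) u)"
proof -
  define r where "r = (LEAST r. (h ^^ r) u \<in> Y)"
  have tY: "(h ^^ t) u \<in> Y"
    using t subspace_0[OF Y(1)] by simp
  have rt: "r \<le> t"
    unfolding r_def by (rule Least_le) (fact tY)
  have rY: "(h ^^ r) u \<in> Y"
    unfolding r_def by (rule LeastI) (fact tY)
  have "y \<in> cyclic_subspace scale h ((h ^^ r) u)" if y: "y \<in> Y" "y \<noteq> 0" for y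
  proof -
    obtain m where m: "y \<in> cyclic_subspace scale h ((h ^^ m) u)" "(h ^^ m) u \<in> cyclic_subspace scale h y"
      using nilpotent_cyclic_associate[OF h t, of y] y Y(3) by blast
    have "(h ^^ m) u \<in> Y"
      using m(2) cyclic_subspace_minimal[OF h Y(1,2) y(1)] by blast
    then have "r \<le> m"
      unfolding r_def by (rule Least_le)
    then have "(h ^^ m) u = (h ^^ (m - r)) ((h ^^ r) u)"
      by (metis comp_apply funpow_add le_add_diff_inverse2)
    then have "(h ^^ m) u \<in> cyclic_subspace scale h ((h ^^ r) u)"
      using generator_in_cyclic[OF h] by metis
    then show ?thesis
      using m(1) cyclic_subspace_minimal[OF h subspace_cyclic[OF h] cyclic_subspace_invariant[OF h]]
      by blast
  qed
  then have "Y \<subseteq> cyclic_subspace scale h ((h ^^ r) u)"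
    using subspace_0[OF subspace_cyclic[OF h]] by blast
  with rt show ?thesis
    using cyclic_subspace_minimal[OF h Y(1,2) rY] by blast
qed

text \<open>A vector \<open>u\<close> of maximal height \<open>t\<close> generates a direct summand. Choose a linear functional \<open>\<phi>\<close> with
  \<open>\<phi> ((h ^^ (t - 1)) u) = 1\<close>. The largest invariant subspace of \<open>W\<close> inside the kernel of \<open>\<phi>\<close>, namely
  \<open>{w \<in> W. \<forall>i. \<phi> ((h ^^ i) w) = 0}\<close>, is a complement. It meets the cyclic subspace trivially, since
  every nonzero submodule of the latter contains \<open>(h ^^ (t - 1)) u\<close>; and the two span \<open>W\<close>, since the
  conditions on \<open>w - p\<close> form a triangular linear system for the coefficients of \<open>p\<close>.\<close>

lemma nilpotent_cyclic_complement:
  assumes h: "Vector_Spaces.linear scale scale h" and W: "subspace W" "h ` W \<subseteq> W"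
    and nil: "\<And>w. w \<in> W \<Longrightarrow> (h ^^ N) w = 0" and ne: "W \<noteq> {0}"
  obtains u t Z where "u \<in> W" and "0 < t" and "(h ^^ (t - 1)) u \<noteq> 0" and "(h ^^ t) u = 0"
    and "subspace Z" and "h ` Z \<subseteq> Z" and "Z \<subseteq> W"
    and "cyclic_subspace scale h u \<inter> Z \<subseteq> {0}"
    and "\<And>w. w \<in> W \<Longrightarrow> \<exists>p\<in>cyclic_subspace scale h u. w - p \<in> Z"
proof -
  define t where "t = (LEAST t. \<forall>w\<in>W. (h ^^ t) w = 0)"
  have kill: "(h ^^ t) w = 0" if "w \<in> W" for w
  proof -
    have "\<forall>w\<in>W. (h ^^ t) w = 0"
      unfolding t_def by (rule LeastI[of _ N]) (use nil in blast)
    then show ?thesis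
      using that by blast
  qed
  have t0: "0 < t"
  proof (rule ccontr)
    assume "\<not> 0 < t"
    then have "\<forall>w\<in>W. w = 0"
      using kill by auto
    then show False
      using ne subspace_0[OF W(1)] by blast
  qed
  have "\<not> (\<forall>w\<in>W. (h ^^ (t - 1)) w = 0)"
    using not_less_Least[of "t - 1" "\<lambda>t. \<forall>w\<in>W. (h ^^ t) w = 0"] t0 unfolding t_def[symmetric] by simp
  then obtain u where u: "u \<in> W" "(h ^^ (t - 1)) u \<noteq> 0"
    by blast
  define z where "z = (h ^^ (t - 1)) u"
  have indep: "independent {z}"
    using u(2) by (simp add: z_def)
  define \<phi> where "\<phi> = (\<lambda>v. representation (extend_basis {z}) v z)"
  have "Vector_Spaces.linear scale (*) \<phi>"
    unfolding \<phi>_def by (intro linear_representation independent_extend_basis span_extend_basis indep)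
  then interpret \<phi>: Vector_Spaces.linear scale "(*)" \<phi> .
  have "z \<in> extend_basis {z}"
    using extend_basis_superset[OF indep] by simp
  then have \<phi>z: "\<phi> z = 1"
    using representation_basis[OF independent_extend_basis[OF indep]] by (simp add: \<phi>_def)
  interpret h: Vector_Spaces.linear scale scale h by (fact h)
  have hi: "(h ^^ i) (v + w) = (h ^^ i) v + (h ^^ i) w"
           "(h ^^ i) (v - w) = (h ^^ i) v - (h ^^ i) w" 
           "(h ^^ i) (a *s v) = a *s (h ^^ i) v"
           "(h ^^ i) 0 = 0" for i a v w
    by (induction i) (auto simp: h.add h.diff h.scale h.zero)
  define Z where "Z = {w \<in> W. \<forall>i. \<phi> ((h ^^ i) w) = 0}"
  have Z: "subspace Z"
    unfolding Z_def
    by (rule subspaceI)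
       (use W(1) in \<open>auto simp: hi \<phi>.add \<phi>.scale \<phi>.zero subspace_0 subspace_add subspace_scale\<close>)
  have hZ: "h ` Z \<subseteq> Z"
  proof (clarify)
    fix w
    assume w: "w \<in> Z"
    have "\<phi> ((h ^^ i) (h w)) = 0" for i
    proof -
      have "\<phi> ((h ^^ Suc i) w) = 0"
        using w unfolding Z_def by blast
      then show ?thesis
        by (simp add: funpow_swap1)
    qed
    then show "h w \<in> Z"
      using w W(2) by (auto simp: Z_def)
  qed
  have int: "cyclic_subspace scale h u \<inter> Z \<subseteq> {0}"
  proof (rule ccontr)
    assume "\<not> cyclic_subspace scale h u \<inter> Z \<subseteq> {0}"
    then obtain x where x: "x \<in> cyclic_subspace scale h u" "x \<noteq> 0" "x \<in> Z"
      by blast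
    obtain m where m: "m < t" "(h ^^ m) u \<in> cyclic_subspace scale h x"
      using nilpotent_cyclic_associate[OF h kill[OF u(1)] x(1,2)] by blast
    have "(h ^^ m) u \<in> Z"
      using m(2) cyclic_subspace_minimal[OF h Z hZ x(3)] by blast
    then have "\<phi> ((h ^^ (t - 1 - m)) ((h ^^ m) u)) = 0"
      by (simp add: Z_def)
    moreover have "(h ^^ (t - 1 - m)) ((h ^^ m) u) = z"
      unfolding z_def using m(1) by (simp flip: funpow_add[unfolded fun_eq_iff comp_def, rule_format])
    ultimately show False
      using \<phi>z by simp
  qed
  have cycW: "cyclic_subspace scale h u \<subseteq> W"
    by (rule cyclic_subspace_minimal[OF h W u(1)])
  have ex: "\<exists>p\<in>cyclic_subspace scale h u. w - p \<in> Z" if w: "w \<in> W" for w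
  proof -
    \<comment> \<open>Solve for \<open>p\<close> by back substitution: the equations for the highest exponents come first,
      and adding a multiple of \<open>(h ^^ m) u\<close> does not affect the equations already satisfied.\<close>
    have "\<exists>p\<in>cyclic_subspace scale h u. \<forall>i\<ge>t - m. \<phi> ((h ^^ i) (w - p)) = 0" if "m \<le> t" for m
      using that
    proof (induction m)
      case 0
      have "(h ^^ i) w = 0" if "t \<le> i" for i
        using funpow_zero_mono[OF h kill[OF w] that] .
      then show ?case
        using subspace_0[OF subspace_cyclic[OF h]] by (intro bexI[of _ 0]) (auto simp: \<phi>.zero)
    next
      case (Suc m)
      then obtain p where p: "p \<in> cyclic_subspace scale h u"
        and low: "\<And>i. t - m \<le> i \<Longrightarrow> \<phi> ((h ^^ i) (w - p)) = 0"
        by auto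
      define j where "j = t - Suc m"
      define c where "c = \<phi> ((h ^^ j) (w - p))"
      define p' where "p' = p + c *s (h ^^ m) u"
      have "p' \<in> cyclic_subspace scale h u"
        unfolding p'_def
        by (intro subspace_add subspace_scale subspace_cyclic[OF h] p generator_in_cyclic[OF h])
      moreover have "\<phi> ((h ^^ i) (w - p')) = 0" if i: "j \<le> i" for i
      proof -
        have "\<phi> ((h ^^ i) (w - p')) = \<phi> ((h ^^ i) (w - p)) - c * \<phi> ((h ^^ (i + m)) u)"
          unfolding p'_def by (simp add: hi \<phi>.add \<phi>.diff \<phi>.scale funpow_add)
        also have "\<dots> = 0"
        proof (cases "i = j")
          case True
          then have "i + m = t - 1"
            using Suc.prems by (simp add: j_def)
          then have "(h ^^ (i + m)) u = z"
            by (simp only: z_def)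
          then show ?thesis
            using True \<phi>z by (simp add: c_def)
        next
          case False
          then have "t - m \<le> i" "t \<le> i + m"
            using i Suc.prems by (auto simp: j_def)
          then show ?thesis
            using low funpow_zero_mono[OF h kill[OF u(1)]] by (simp add: \<phi>.zero)
        qed
        finally show ?thesis .
      qed
      ultimately show ?case
        unfolding j_def by blast
    qed
    from this[of t] obtain p where "p \<in> cyclic_subspace scale h u" "\<forall>i. \<phi> ((h ^^ i) (w - p)) = 0"
      by auto
    then show ?thesis
      using w cycW subspace_diff[OF W(1)] unfolding Z_def by blast
  qed
  show ?thesis
    by (rule that[OF u(1) t0 u(2) kill[OF u(1)] Z hZ _ int ex]) (auto simp: Z_def)
qed

end

context finite_dimensional_vector_space
begin

theorem nilpotent_cyclic_decomposition:
  assumes h: "Vector_Spaces.linear scale scale h" and W: "subspace W" "h ` W \<subseteq> W"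
    and nil: "\<And>w. w \<in> W \<Longrightarrow> (h ^^ N) w = 0"
  shows "\<exists>k t u. (\<forall>i<k. 0 < t i) \<and> generators scale h W k t u"
  using W nil
proof (induction "dim W" arbitrary: W rule: less_induct)
  case less
  show ?case
  proof (cases "W = {0}")
    case True
    then have "generators scale h W 0 (\<lambda>_. 0) (\<lambda>_. 0)"
      by (auto simp: generators_def internal_direct_sum_def)
    then show ?thesis
      by blast
  next
    case False
    obtain u0 t0 Z where u: "u0 \<in> W" "0 < t0" "(h ^^ (t0 - 1)) u0 \<noteq> 0" "(h ^^ t0) u0 = 0"
      and Z: "subspace Z" "h ` Z \<subseteq> Z" "Z \<subseteq> W"
      and int: "cyclic_subspace scale h u0 \<inter> Z \<subseteq> {0}"
      and ex: "\<And>w. w \<in> W \<Longrightarrow> \<exists>p\<in>cyclic_subspace scale h u0. w - p \<in> Z"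
      using nilpotent_cyclic_complement[OF h less.prems False] by metis
    have "u0 \<noteq> 0"
      using u(3) funpow_zero_mono[OF h, of 0 u0 "t0 - 1"] by auto
    then have "u0 \<notin> Z"
      using int generator_in_cyclic[OF h, of 0 u0] by auto
    then have "dim Z < dim W"
      using u(1) Z less.prems(1) by (intro dim_psubset) (auto simp: span_eq_iff[THEN iffD2])
    then obtain k t v where IH: "\<forall>i<k. 0 < t i" "generators scale h Z k t v"
      using less.hyps[OF _ Z(1,2)] less.prems(3) Z(3) by blast
    let ?t = "t(k := t0)" and ?v = "v(k := u0)"
    have "internal_direct_sum k (\<lambda>i. cyclic_subspace scale h (?v i)) Z"
      using IH(2) internal_direct_sum_cong[of k "\<lambda>i. cyclic_subspace scale h (?v i)"
          "\<lambda>i. cyclic_subspace scale h (v i)"] by (simp add: generators_def)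
    moreover have "cyclic_subspace scale h u0 \<subseteq> W"
      by (rule cyclic_subspace_minimal[OF h less.prems(1,2) u(1)])
    ultimately have "internal_direct_sum (Suc k) (\<lambda>i. cyclic_subspace scale h (?v i)) W"
      using Z less.prems(1) int ex subspace_cyclic[OF h]
      by (intro direct_sum_Suc[where Z = Z]) auto
    then have "generators scale h W (Suc k) ?t ?v"
      using IH(2) u by (auto simp: generators_def less_Suc_eq)
    moreover have "\<forall>i<Suc k. 0 < ?t i"
      using IH(1) u(2) by (simp add: less_Suc_eq)
    ultimately show ?thesis
      by blast
  qed
qed

end
section \<open>Characteristic, marked and hyperinvariant subspaces\<close>

context vector_space
begin

lemma End_comm_inv:
  assumes "g \<in> Aut_comm scale f"
  shows "inv_into UNIV g \<in> End_comm scale f"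
proof -
  have lin: "Vector_Spaces.linear scale scale g" and com: "g \<circ> f = f \<circ> g" and bij: "bij g"
    using assms by (auto simp: Aut_comm_def End_comm_def)
  interpret g: Vector_Spaces.linear scale scale g by (fact lin)
  have gi: "inv_into UNIV g (g v) = v" "g (inv_into UNIV g v) = v" for v
    using bij by (simp_all add: bij_is_inj bij_is_surj surj_f_inv_f)
  have "Vector_Spaces.linear scale scale (inv_into UNIV g)"
  proof (rule linearI)
    show "inv_into UNIV g (v + w) = inv_into UNIV g v + inv_into UNIV g w" for v w
      by (metis g.add gi)
    show "inv_into UNIV g (a *s v) = a *s inv_into UNIV g v" for a v
      by (metis g.scale gi)
  qed
  moreover have "inv_into UNIV g (f v) = f (inv_into UNIV g v)" for v
    using com by (metis comp_apply gi)
  ultimately show ?thesis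
    by (auto simp: End_comm_def)
qed

text \<open>The inverse of an automorphism commuting with \<open>f\<close> also commutes with \<open>f\<close>, so both map \<open>X\<close> into
  itself.\<close>

lemma hyperinvariant_imp_characteristic:
  assumes f: "Vector_Spaces.linear scale scale f" and X: "X \<in> Hinv scale f"
  shows "X \<in> Chinv scale f"
proof -
  have stable: "g ` X \<subseteq> X" if "g \<in> End_comm scale f" for g
    using X that by (simp add: Hinv_def)
  have "g ` X = X" if g: "g \<in> Aut_comm scale f" for g
  proof
    show "g ` X \<subseteq> X"
      using g stable by (simp add: Aut_comm_def)
    have "bij g"
      using g by (simp add: Aut_comm_def)
    then have "X = g ` (inv_into UNIV g ` X)"
      by (simp add: image_f_inv_f bij_is_surj)
    then show "X \<subseteq> g ` X"
      using stable[OF End_comm_inv[OF g]] by blast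
  qed
  then show ?thesis
    using X stable[OF End_comm_self[OF f]] by (auto simp: Chinv_def Inv_def Hinv_def)
qed

text \<open>Here \<open>\<iota> + \<eta>\<close> is an automorphism with inverse \<open>\<iota> - \<eta>\<close>, and \<open>\<eta> x\<close> is the difference of
  \<open>(\<iota> + \<eta>) x\<close> and \<open>x\<close>.\<close>

lemma characteristic_square_zero:
  assumes X: "X \<in> Chinv scale f" and f: "Vector_Spaces.linear scale scale f"
    and n: "\<eta> \<in> End_comm scale f" and sq: "\<And>v. \<eta> (\<eta> v) = 0" and x: "x \<in> X"
  shows "\<eta> x \<in> X"
proof -
  have lin: "Vector_Spaces.linear scale scale \<eta>" and com: "\<eta> \<circ> f = f \<circ> \<eta>"
    using n by (auto simp: End_comm_def)
  interpret f: Vector_Spaces.linear scale scale f by (fact f)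
  interpret n: Vector_Spaces.linear scale scale \<eta> by (fact lin)
  define \<alpha> where "\<alpha> = (\<lambda>v. v + \<eta> v)"
  have "Vector_Spaces.linear scale scale \<alpha>"
    by (rule linearI) (simp_all add: \<alpha>_def n.add n.scale scale_right_distrib algebra_simps)
  moreover have "\<alpha> \<circ> f = f \<circ> \<alpha>"
    using com by (auto simp: \<alpha>_def fun_eq_iff f.add)
  moreover have "bij \<alpha>"
    by (rule o_bij[of "\<lambda>v. v - \<eta> v"]) (auto simp: \<alpha>_def fun_eq_iff n.add n.diff sq)
  ultimately have "\<alpha> \<in> Aut_comm scale f"
    by (simp add: Aut_comm_def End_comm_def)
  then have "\<alpha> x \<in> X"
    using X x unfolding Chinv_def by blast
  moreover have "subspace X"
    using X by (simp add: Chinv_def Inv_def)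
  ultimately show ?thesis
    using subspace_diff[of X "\<alpha> x" x] x by (simp add: \<alpha>_def)
qed

end

context finite_dimensional_vector_space
begin

text \<open>The projections belong to \<open>End_comm\<close>, that is, they are defined on the whole space, so that they can
  be composed with an arbitrary map commuting with \<open>f\<close>.\<close>

lemma gen_eigenspace_projections:
  assumes f: "Vector_Spaces.linear scale scale f"
    and ds: "internal_direct_sum k C (gen_eigenspace scale f c)"
    and C: "\<And>i. subspace (C i)" "\<And>i. shifted scale f c ` C i \<subseteq> C i"
  obtains \<pi> where "\<And>i. i < k \<Longrightarrow> \<pi> i \<in> End_comm scale f"
    and "\<And>i v. i < k \<Longrightarrow> \<pi> i v \<in> C i"
    and "\<And>w. w \<in> gen_eigenspace scale f c \<Longrightarrow> (\<Sum>i<k. \<pi> i w) = w"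
    and "\<And>i x. i < k \<Longrightarrow> x \<in> C i \<Longrightarrow> \<pi> i x = x"
    and "\<And>i j x. i < k \<Longrightarrow> j < k \<Longrightarrow> i \<noteq> j \<Longrightarrow> x \<in> C j \<Longrightarrow> \<pi> i x = 0"
proof -
  obtain e where e: "\<And>v. poly_act scale f e v \<in> gen_eigenspace scale f c"
    "\<And>v. v \<in> gen_eigenspace scale f c \<Longrightarrow> poly_act scale f e v = v"
    using primary_projection[OF f] by blast
  have "f ` C i \<subseteq> C i" for i
    using C(2) invariant_shifted_iff[OF C(1)] by blast
  from direct_sum_projections[OF ds C(1) this f End_comm_poly_act[OF f] e]
  show ?thesis
    using that by blast
qed

text \<open>Any cyclic decomposition of the generalized eigenspace is adapted to \<open>X\<close>, since its projections
  preserve \<open>X\<close>.\<close>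

lemma hyperinvariant_imp_marked:
  assumes f: "Vector_Spaces.linear scale scale f" and X: "X \<in> Hinv scale f"
  shows "X \<in> Mark scale f"
proof -
  have sX: "subspace X" and stable: "\<And>g x. g \<in> End_comm scale f \<Longrightarrow> x \<in> X \<Longrightarrow> g x \<in> X"
    using X by (auto simp: Hinv_def)
  have fX: "f ` X \<subseteq> X"
    using stable[OF End_comm_self[OF f]] by blast
  have "marked_in scale (shifted scale f c) (gen_eigenspace scale f c)
          (X \<inter> gen_eigenspace scale f c)" for c
  proof -
    define h where "h = shifted scale f c"
    define W where "W = gen_eigenspace scale f c"
    have h: "Vector_Spaces.linear scale scale h"
      unfolding h_def by (rule shifted_linear[OF f])
    have W: "subspace W"
      unfolding W_def by (rule gen_eigenspace_subspace[OF f])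
    have "f ` W \<subseteq> W"
      unfolding W_def using gen_eigenspace_hyperinvariant[OF f End_comm_self[OF f]] by blast
    then have hW: "h ` W \<subseteq> W"
      unfolding h_def using invariant_shifted_iff[OF W] by blast
    have hX: "h ` X \<subseteq> X"
      unfolding h_def using invariant_shifted_iff[OF sX] fX by blast
    have "(h ^^ dim UNIV) w = 0" if "w \<in> W" for w
      using that by (simp add: W_def h_def gen_eigenspace_def)
    then obtain k t u where t: "\<forall>i<k. 0 < t i" and gen: "generators scale h W k t u"
      using nilpotent_cyclic_decomposition[OF h W hW] by blast
    define C where "C = (\<lambda>i. cyclic_subspace scale h (u i))"
    have ds: "internal_direct_sum k C W"
      using gen by (simp add: generators_def C_def)
    have C: "subspace (C i)" "h ` C i \<subseteq> C i" for i
      unfolding C_def by (rule subspace_cyclic[OF h] cyclic_subspace_invariant[OF h])+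
    have CW: "C i \<subseteq> W" if "i < k" for i
      by (rule direct_sum_summand[OF ds C(1) that])
    obtain \<pi> where \<pi>: "\<And>i. i < k \<Longrightarrow> \<pi> i \<in> End_comm scale f"
      "\<And>i v. i < k \<Longrightarrow> \<pi> i v \<in> C i" "\<And>w. w \<in> W \<Longrightarrow> (\<Sum>i<k. \<pi> i w) = w"
      by (rule gen_eigenspace_projections[OF f ds[unfolded W_def] C[unfolded h_def], folded W_def])
       (rule that)
    have "\<exists>r\<le>t i. X \<inter> C i = cyclic_subspace scale h ((h ^^ r) (u i))" if "i < k" for i
    proof (rule cyclic_nilpotent_submodule[OF h])
      show "(h ^^ t i) (u i) = 0"
        using gen that by (simp add: generators_def)
      show "subspace (X \<inter> C i)"
        by (rule subspace_inter[OF sX C(1)])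
      show "h ` (X \<inter> C i) \<subseteq> X \<inter> C i"
        using hX C(2) by blast
    qed (simp add: C_def)
    then obtain r where r: "\<And>i. i < k \<Longrightarrow> r i \<le> t i"
      "\<And>i. i < k \<Longrightarrow> X \<inter> C i = cyclic_subspace scale h ((h ^^ r i) (u i))"
      by metis
    have "internal_direct_sum k (\<lambda>i. X \<inter> C i) (X \<inter> W)"
    proof -
      have "\<exists>a. x = (\<Sum>i<k. a i) \<and> (\<forall>i<k. a i \<in> X \<inter> C i)" if "x \<in> X \<inter> W" for x
        using that \<pi> stable by (intro exI[of _ "\<lambda>i. \<pi> i x"]) auto
      moreover have "(\<Sum>i<k. a i) \<in> X \<inter> W" if "\<forall>i<k. a i \<in> X \<inter> C i" for a
        using that CW sX W by (intro subspace_sum subspace_inter) auto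
      moreover have "\<forall>i<k. a i = 0" if "\<forall>i<k. a i \<in> X \<inter> C i" "(\<Sum>i<k. a i) = 0" for a
        using that ds unfolding internal_direct_sum_def by blast
      ultimately show ?thesis
        unfolding internal_direct_sum_def by blast
    qed
    then have "internal_direct_sum k (\<lambda>i. cyclic_subspace scale h ((h ^^ r i) (u i))) (X \<inter> W)"
      by (rule iffD1[OF internal_direct_sum_cong, rotated]) (simp add: r(2))
    then show ?thesis
      using t gen r(1) unfolding marked_in_def elementary_divisors_def W_def h_def by blast
  qed
  then show ?thesis
    using sX fX by (simp add: Mark_def Inv_def)
qed

text \<open>The matrix entries \<open>\<pi> j \<circ> g \<circ> \<pi> i\<close> of \<open>g\<close> are treated one by one: the diagonal ones are
  multiplications on a cyclic module, the others have square zero.\<close>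

lemma characteristic_marked_component:
  assumes f: "Vector_Spaces.linear scale scale f" and X: "X \<in> Chinv scale f"
    and marked: "marked_in scale (shifted scale f c) (gen_eigenspace scale f c)
                   (X \<inter> gen_eigenspace scale f c)"
    and g: "g \<in> End_comm scale f" and x: "x \<in> X \<inter> gen_eigenspace scale f c"
  shows "g x \<in> X"
proof (cases "X \<inter> gen_eigenspace scale f c = {0}")
  case True
  have "Vector_Spaces.linear scale scale g"
    using g by (simp add: End_comm_def)
  then interpret g: Vector_Spaces.linear scale scale g .
  show ?thesis
    using True x by (metis IntD1 g.zero singletonD)
next
  case False
  define h where "h = shifted scale f c"
  define W where "W = gen_eigenspace scale f c"
  have sX: "subspace X" and fX: "f ` X \<subseteq> X"
    using X by (auto simp: Chinv_def Inv_def)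
  have h: "Vector_Spaces.linear scale scale h"
    unfolding h_def by (rule shifted_linear[OF f])
  have hX: "h ` X \<subseteq> X"
    unfolding h_def using invariant_shifted_iff[OF sX] fX by blast
  have glin: "Vector_Spaces.linear scale scale g"
    using g by (simp add: End_comm_def)
  interpret g: Vector_Spaces.linear scale scale g by (fact glin)
  obtain k t u r where gen: "generators scale h W k t u"
    and Y: "internal_direct_sum k (\<lambda>i. cyclic_subspace scale h ((h ^^ r i) (u i))) (X \<inter> W)"
    using marked False unfolding marked_in_def h_def W_def by blast
  define C where "C = (\<lambda>i. cyclic_subspace scale h (u i))"
  have ds: "internal_direct_sum k C W"
    using gen by (simp add: generators_def C_def)
  have C: "subspace (C i)" "h ` C i \<subseteq> C i" for i
    unfolding C_def by (rule subspace_cyclic[OF h] cyclic_subspace_invariant[OF h])+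
  obtain \<pi> where \<pi>: "\<And>i. i < k \<Longrightarrow> \<pi> i \<in> End_comm scale f" "\<And>i v. i < k \<Longrightarrow> \<pi> i v \<in> C i"
    "\<And>w. w \<in> W \<Longrightarrow> (\<Sum>i<k. \<pi> i w) = w" "\<And>i x. i < k \<Longrightarrow> x \<in> C i \<Longrightarrow> \<pi> i x = x"
    "\<And>i j x. i < k \<Longrightarrow> j < k \<Longrightarrow> i \<noteq> j \<Longrightarrow> x \<in> C j \<Longrightarrow> \<pi> i x = 0"
    by (rule gen_eigenspace_projections[OF f ds[unfolded W_def] C[unfolded h_def], folded W_def])
       (rule that)
  have "x \<in> {\<Sum>i<k. p i |p. \<forall>i<k. p i \<in> cyclic_subspace scale h ((h ^^ r i) (u i))}"
    using x Y unfolding internal_direct_sum_def W_def by blast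
  then obtain p where xp: "x = (\<Sum>i<k. p i)"
    and p: "\<And>i. i < k \<Longrightarrow> p i \<in> cyclic_subspace scale h ((h ^^ r i) (u i))"
    by blast
  have pX: "p i \<in> X \<inter> W" if "i < k" for i
    using direct_sum_summand[OF Y subspace_cyclic[OF h] that] p[OF that] by blast
  have pC: "p i \<in> C i" if "i < k" for i
    using p[OF that] cyclic_subspace_minimal[OF h C, of "(h ^^ r i) (u i)" i] generator_in_cyclic[OF h]
    unfolding C_def by blast
  have entry: "\<pi> j (g (p i)) \<in> X" if i: "i < k" and j: "j < k" for i j
  proof (cases "i = j")
    case True
    \<comment> \<open>The endomorphism \<open>\<pi> i \<circ> g\<close> maps \<open>C i\<close> into itself, so it acts there as a polynomial in \<open>h\<close>.\<close>
    have e: "\<pi> i \<circ> g \<in> End_comm scale f"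
      by (rule End_comm_comp[OF \<pi>(1)[OF i] g])
    then have lin: "Vector_Spaces.linear scale scale (\<pi> i \<circ> g)"
      and com: "(\<pi> i \<circ> g) \<circ> f = f \<circ> (\<pi> i \<circ> g)"
      unfolding End_comm_def by blast+
    have "(\<pi> i \<circ> g) (p i) \<in> X"
    proof (rule commuting_map_cyclic[OF h lin _ _ sX hX])
      show "(\<pi> i \<circ> g) \<circ> h = h \<circ> (\<pi> i \<circ> g)"
        unfolding h_def by (rule shifted_commute[OF lin com])
      show "(\<pi> i \<circ> g) (u i) \<in> cyclic_subspace scale h (u i)"
        using \<pi>(2)[OF i] by (simp add: C_def)
      show "p i \<in> X"
        using pX[OF i] by blast
      show "p i \<in> cyclic_subspace scale h (u i)"
        using pC[OF i] by (simp add: C_def)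
    qed
    then show ?thesis
      using True by simp
  next
    case False
    \<comment> \<open>The middle factor of \<open>\<pi> j \<circ> g \<circ> \<pi> i \<circ> \<pi> j \<circ> g \<circ> \<pi> i\<close> is \<open>\<pi> i \<circ> \<pi> j = 0\<close>.\<close>
    have e: "\<pi> j \<circ> (g \<circ> \<pi> i) \<in> End_comm scale f"
      by (intro End_comm_comp \<pi>(1) g i j)
    have "\<pi> i (\<pi> j v) = 0" for v
      by (rule \<pi>(5)[OF i j False \<pi>(2)[OF j]])
    moreover have "\<pi> j 0 = 0"
      using \<pi>(4)[OF j subspace_0[OF C(1)]] .
    ultimately have "(\<pi> j \<circ> (g \<circ> \<pi> i)) ((\<pi> j \<circ> (g \<circ> \<pi> i)) v) = 0" for v
      by (simp add: g.zero)
    from characteristic_square_zero[OF X f e this] pX[OF i]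
    have "(\<pi> j \<circ> (g \<circ> \<pi> i)) (p i) \<in> X"
      by blast
    then show ?thesis
      using \<pi>(4)[OF i pC[OF i]] by simp
  qed
  have "g x = (\<Sum>i<k. g (p i))"
    unfolding xp by (rule g.sum)
  also have "\<dots> = (\<Sum>i<k. \<Sum>j<k. \<pi> j (g (p i)))"
  proof (rule sum.cong[OF refl])
    fix i
    assume "i \<in> {..<k}"
    then have "g (p i) \<in> W"
      using pX gen_eigenspace_hyperinvariant[OF f g] unfolding W_def by blast
    then show "g (p i) = (\<Sum>j<k. \<pi> j (g (p i)))"
      using \<pi>(3) by simp
  qed
  also have "\<dots> \<in> X"
    using entry by (intro subspace_sum[OF sX]) auto
  finally show ?thesis .
qed

lemma characteristic_marked_imp_hyperinvariant:
  assumes f: "Vector_Spaces.linear scale scale f" and split: "char_polynomial_splits scale f"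
    and X: "X \<in> Chinv scale f" and M: "X \<in> Mark scale f"
  shows "X \<in> Hinv scale f"
proof -
  have sX: "subspace X" and fX: "f ` X \<subseteq> X"
    using X by (auto simp: Chinv_def Inv_def)
  have "g ` X \<subseteq> X" if g: "g \<in> End_comm scale f" for g
  proof -
    have "Vector_Spaces.linear scale scale g"
      using g by (simp add: End_comm_def)
    then interpret g: Vector_Spaces.linear scale scale g .
    have "g x \<in> X" if x: "x \<in> X \<inter> gen_eigenspace scale f c" for x c
    proof (rule characteristic_marked_component[OF f X _ g x])
      show "marked_in scale (shifted scale f c) (gen_eigenspace scale f c)
              (X \<inter> gen_eigenspace scale f c)"
      proof (cases "is_eigenvalue scale f c")
        case True
        then show ?thesis
          using M by (simp add: Mark_def)
      next
        case False
        then show ?thesis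
          using gen_eigenspace_trivial[OF f] subspace_0[OF sX] by (simp add: marked_in_def)
      qed
    qed
    then have "g ` span (\<Union>c. X \<inter> gen_eigenspace scale f c) \<subseteq> X"
      unfolding g.span_image[symmetric] by (intro span_minimal sX) auto
    then show ?thesis
      using invariant_subspace_primary_decomposition[OF f split sX fX] by blast
  qed
  then show ?thesis
    using sX by (simp add: Hinv_def)
qed

end

theorem theorem3p2:
  fixes scale :: "'k::field \<Rightarrow> 'v::ab_group_add \<Rightarrow> 'v"
    and Basis :: "'v set"
    and f :: "'v \<Rightarrow> 'v"
  assumes "finite_dimensional_vector_space scale Basis"
    and "Vector_Spaces.linear scale scale f"
    and "char_polynomial_splits scale f"
  shows "Hinv scale f = Chinv scale f \<inter> Mark scale f"
proof
  interpret finite_dimensional_vector_space scale Basis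
    by (fact assms(1))
  show "Hinv scale f \<subseteq> Chinv scale f \<inter> Mark scale f"
    using hyperinvariant_imp_characteristic[OF assms(2)] hyperinvariant_imp_marked[OF assms(2)]
    by blast
  show "Chinv scale f \<inter> Mark scale f \<subseteq> Hinv scale f"
    using characteristic_marked_imp_hyperinvariant[OF assms(2,3)] by blast
qed

end
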